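(* Assume $\mathcal O$ is finite. If a pair $(\gamma_x,\gamma_y)$ of $0$-chains is a pseudo-decoupling of $(x,y)$, then, with $\widetilde\gamma_x=[G_x]\cdot\gamma_x$, $\widetilde\gamma_y=[G_y]\cdot\gamma_y$ and $\alpha=(x,y)-\widetilde\gamma_x-\widetilde\gamma_y$, one has: $\sigma\cdot\widetilde\gamma_x=\widetilde\gamma_x$ for all $\sigma\in G_x$, $\sigma\cdot\widetilde\gamma_y=\widetilde\gamma_y$ for all $\sigma\in G_y$, and $\alpha$ cancels decoupled fractions (so $(x,y)=\widetilde\gamma_x+\widetilde\gamma_y+\alpha$ is a decoupling of $(x,y)$).
   Context: Fix a finite set $\mathcal S\subset\mathbb Z^2$ and nonzero complex weights; step polynomial $S(X,Y)=\sum_{(i,j)\in\mathcal S}w_{(i,j)}X^iY^j$ with smallest/largest exponents $-m_x,M_x$ in $X$ and $-m_y,M_y$ in $Y$, all positive; kernel $\widetilde K(X,Y,t)=X^{m_x}Y^{m_y}(1-tS(X,Y))$. Let $x,y$ be algebraically independent over $\mathbb C$, $k=\mathbb C(S(x,y))$, $\mathbb K$ an algebraic closure of $\mathbb C(x,y)$. Write $(u,v)\sim^x(u',v')$ if $u=u'$ and $S(u,v)=S(u',v')$, $(u,v)\sim^y(u',v')$ if $v=v'$ and $S(u,v)=S(u',v')$; the orbit $\mathcal O$ is the class of $(x,y)$ under the equivalence relation they generate. $k(\mathcal O)$ is the subfield of $\mathbb K$ generated over $k$ by the coordinates of $\mathcal O$; $G_x=\mathrm{Aut}(k(\mathcal O)|k(x))$,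 $G_y=\mathrm{Aut}(k(\mathcal O)|k(y))$ act coordinatewise on $\mathcal O$ (preserving it, faithfully; they are finite when $\mathcal O$ is finite) and linearly on $0$-chains (finitely supported $\mathbb C$-combinations of elements of $\mathcal O$). For a finite subgroup $G'$, $[G']\cdot\gamma=\frac{1}{|G'|}\sum_{\sigma\in G'}\sigma\cdot\gamma$. A fraction $H=A/B$ ($A,B$ coprime in $\mathbb C[X,Y,t]$) is regular if $\widetilde K\nmid B$; $H_{(u,v)}=H(u,v,1/S(x,y))$, extended linearly. $H$ admits a Galois decoupling if $H=F+E+\widetilde KR$ with $F\in\mathbb C(X,t)$, $E\in\mathbb C(Y,t)$, $R$ regular. $(\gamma_x,\gamma_y)$ is a pseudo-decoupling of $(x,y)$ if for every regular $H$ admitting a Galois decoupling, $H_{(x,y)}=H_{\gamma_x}+H_{\gamma_y}$ with $H_{\gamma_x}\in k(x)$, $H_{\gamma_y}\in k(y)$. A $0$-chain $\alpha$ cancels decoupled fractions if $H_\alpha=0$ for all $H\in\mathbb C(X,t)+\mathbb C(Y,t)$. *)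

theory Defs
  imports
    Complex_Main
    "HOL-Computational_Algebra.Computational_Algebra"
    "HOL-Computational_Algebra.Field_as_Ring"
    "HOL-Library.Poly_Mapping"
    "HOL-Library.FuncSet"
begin

section \<open>Fields\<close>

definition field_embedding :: "('a::field \<Rightarrow> 'b::field) \<Rightarrow> bool" where
  "field_embedding \<iota> \<longleftrightarrow>
     \<iota> 1 = 1 \<and> (\<forall>a b. \<iota> (a + b) = \<iota> a + \<iota> b) \<and> (\<forall>a b. \<iota> (a * b) = \<iota> a * \<iota> b)"

definition is_subfield :: "'a::field set \<Rightarrow> bool" where
  "is_subfield F \<longleftrightarrow>
     0 \<in> F \<and> 1 \<in> F \<and> (\<forall>a\<in>F. \<forall>b\<in>F. a + b \<in> F \<and> a * b \<in> F)
     \<and> (\<forall>a\<in>F. - a \<in> F \<and> inverse a \<in> F)"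

definition adjoin :: "'a::field set \<Rightarrow> 'a set \<Rightarrow> 'a set" where
  "adjoin F A = is_subfield hull (F \<union> A)"

definition algebraic_over :: "'a::field set \<Rightarrow> 'a \<Rightarrow> bool" where
  "algebraic_over F z \<longleftrightarrow> (\<exists>p. p \<noteq> 0 \<and> (\<forall>i. coeff p i \<in> F) \<and> poly p z = 0)"

text \<open>The automorphisms of \<open>L\<close> fixing \<open>F\<close> pointwise; extensionality makes an automorphism of the
  subset \<open>L\<close> of the ambient type correspond to exactly one function.\<close>

definition field_auts :: "'a::field set \<Rightarrow> 'a set \<Rightarrow> ('a \<Rightarrow> 'a) set" where
  "field_auts L F =
     {\<sigma> \<in> extensional L. bij_betw \<sigma> L L
        \<and> (\<forall>a\<in>L. \<forall>b\<in>L. \<sigma> (a + b) = \<sigma> a + \<sigma> b \<and> \<sigma> (a * b) = \<sigma> a * \<sigma> b)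
        \<and> (\<forall>a\<in>F. \<sigma> a = a)}"


section \<open>Polynomials and fractions in several variables\<close>

text \<open>\<open>\<complex>[X,Y]\<close> is \<open>complex poly poly\<close> and \<open>\<complex>[X,Y,t]\<close> is \<open>complex poly poly poly\<close>, where \<open>X\<close> is the
  innermost variable and \<open>t\<close> the outermost one. The map \<open>\<iota>\<close> embeds the constants.\<close>

definition eval2 :: "(complex \<Rightarrow> 'k::field) \<Rightarrow> complex poly poly \<Rightarrow> 'k \<Rightarrow> 'k \<Rightarrow> 'k" where
  "eval2 \<iota> p u v = poly (map_poly (\<lambda>q. poly (map_poly \<iota> q) u) p) v"

definition eval3 :: "(complex \<Rightarrow> 'k::field) \<Rightarrow> complex poly poly poly \<Rightarrow> 'k \<Rightarrow> 'k \<Rightarrow> 'k \<Rightarrow> 'k" where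
  "eval3 \<iota> p u v s = poly (map_poly (\<lambda>q. eval2 \<iota> q u v) p) s"

definition monom3 :: "complex \<Rightarrow> nat \<Rightarrow> nat \<Rightarrow> nat \<Rightarrow> complex poly poly poly" where
  "monom3 c a b d = monom (monom (monom c a) b) d"

type_synonym fraction = "complex poly poly poly fract"

definition constants :: "fraction set" where
  "constants = range (\<lambda>c. to_fract (monom3 c 0 0 0))"

definition fractions_X_t :: "fraction set" where
  "fractions_X_t = adjoin constants {to_fract (monom3 1 1 0 0), to_fract (monom3 1 0 0 1)}"

definition fractions_Y_t :: "fraction set" where
  "fractions_Y_t = adjoin constants {to_fract (monom3 1 0 1 0), to_fract (monom3 1 0 0 1)}"

text \<open>\<open>quot_of_fract\<close> yields the coprime numerator and denominator (with normalized
  denominator).\<close>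

definition eval_fraction :: "(complex \<Rightarrow> 'k::field) \<Rightarrow> fraction \<Rightarrow> 'k \<Rightarrow> 'k \<Rightarrow> 'k \<Rightarrow> 'k" where
  "eval_fraction \<iota> H u v s =
     (case quot_of_fract H of (A, B) \<Rightarrow> eval3 \<iota> A u v s / eval3 \<iota> B u v s)"

definition alg_independent2 :: "(complex \<Rightarrow> 'k::field) \<Rightarrow> 'k \<Rightarrow> 'k \<Rightarrow> bool" where
  "alg_independent2 \<iota> x y \<longleftrightarrow> (\<forall>p. eval2 \<iota> p x y = 0 \<longrightarrow> p = 0)"

text \<open>The type \<open>'k\<close>, with the constants embedded by \<open>\<iota>\<close>, is an algebraic closure of \<open>\<complex>(x,y)\<close>.\<close>

definition alg_closure_of_Cxy :: "(complex \<Rightarrow> 'k::alg_closed_field) \<Rightarrow> 'k \<Rightarrow> 'k \<Rightarrow> bool" where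
  "alg_closure_of_Cxy \<iota> x y \<longleftrightarrow>
     field_embedding \<iota> \<and> alg_independent2 \<iota> x y
     \<and> (\<forall>z. algebraic_over (adjoin (range \<iota>) {x, y}) z)"


section \<open>Step polynomial, kernel, orbit\<close>

definition weighted_steps :: "(int \<times> int) set \<Rightarrow> (int \<times> int \<Rightarrow> complex) \<Rightarrow> bool" where
  "weighted_steps \<S> w \<longleftrightarrow>
     finite \<S> \<and> \<S> \<noteq> {} \<and> (\<forall>s\<in>\<S>. w s \<noteq> 0)
     \<and> - Min (fst ` \<S>) > 0 \<and> Max (fst ` \<S>) > 0
     \<and> - Min (snd ` \<S>) > 0 \<and> Max (snd ` \<S>) > 0"

definition step_poly ::
    "(complex \<Rightarrow> 'k::field) \<Rightarrow> (int \<times> int) set \<Rightarrow> (int \<times> int \<Rightarrow> complex) \<Rightarrow> 'k \<Rightarrow> 'k \<Rightarrow> 'k" where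
  "step_poly \<iota> \<S> w u v = (\<Sum>(i, j)\<in>\<S>. \<iota> (w (i, j)) * u powi i * v powi j)"

text \<open>\<open>X^m\<^sub>x Y^m\<^sub>y (1 - t S(X,Y))\<close> expanded, so that all exponents are natural numbers.\<close>

definition kernel ::
    "(int \<times> int) set \<Rightarrow> (int \<times> int \<Rightarrow> complex) \<Rightarrow> complex poly poly poly" where
  "kernel \<S> w =
     (let m\<^sub>x = - Min (fst ` \<S>); m\<^sub>y = - Min (snd ` \<S>)
      in monom3 1 (nat m\<^sub>x) (nat m\<^sub>y) 0
         - (\<Sum>(i, j)\<in>\<S>. monom3 (w (i, j)) (nat (i + m\<^sub>x)) (nat (j + m\<^sub>y)) 1))"

text \<open>\<open>S\<close> is a Laurent polynomial, so \<open>S(u,v)\<close> is meaningful for nonzero \<open>u\<close>, \<open>v\<close> only; in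
  Isabelle/HOL it would otherwise take junk values. The relations live on pairs of nonzero
  elements.\<close>

definition nonzero_pair :: "'k::field \<times> 'k \<Rightarrow> bool" where
  "nonzero_pair p \<longleftrightarrow> fst p \<noteq> 0 \<and> snd p \<noteq> 0"

definition sim_x ::
    "(complex \<Rightarrow> 'k::field) \<Rightarrow> (int \<times> int) set \<Rightarrow> (int \<times> int \<Rightarrow> complex) \<Rightarrow> 'k \<times> 'k \<Rightarrow> 'k \<times> 'k \<Rightarrow> bool" where
  "sim_x \<iota> \<S> w p q \<longleftrightarrow> nonzero_pair p \<and> nonzero_pair q \<and> fst p = fst q
     \<and> step_poly \<iota> \<S> w (fst p) (snd p) = step_poly \<iota> \<S> w (fst q) (snd q)"

definition sim_y ::
    "(complex \<Rightarrow> 'k::field) \<Rightarrow> (int \<times> int) set \<Rightarrow> (int \<times> int \<Rightarrow> complex) \<Rightarrow> 'k \<times> 'k \<Rightarrow> 'k \<times> 'k \<Rightarrow> bool" where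
  "sim_y \<iota> \<S> w p q \<longleftrightarrow> nonzero_pair p \<and> nonzero_pair q \<and> snd p = snd q
     \<and> step_poly \<iota> \<S> w (fst p) (snd p) = step_poly \<iota> \<S> w (fst q) (snd q)"

definition orbit ::
    "(complex \<Rightarrow> 'k::field) \<Rightarrow> (int \<times> int) set \<Rightarrow> (int \<times> int \<Rightarrow> complex) \<Rightarrow> 'k \<Rightarrow> 'k \<Rightarrow> ('k \<times> 'k) set" where
  "orbit \<iota> \<S> w x y =
     {p. equivclp (\<lambda>q r. sim_x \<iota> \<S> w q r \<or> sim_y \<iota> \<S> w q r) (x, y) p}"

definition base_field ::
    "(complex \<Rightarrow> 'k::field) \<Rightarrow> (int \<times> int) set \<Rightarrow> (int \<times> int \<Rightarrow> complex) \<Rightarrow> 'k \<Rightarrow> 'k \<Rightarrow> 'k set" where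
  "base_field \<iota> \<S> w x y = adjoin (range \<iota>) {step_poly \<iota> \<S> w x y}"

definition orbit_field ::
    "(complex \<Rightarrow> 'k::field) \<Rightarrow> (int \<times> int) set \<Rightarrow> (int \<times> int \<Rightarrow> complex) \<Rightarrow> 'k \<Rightarrow> 'k \<Rightarrow> 'k set" where
  "orbit_field \<iota> \<S> w x y =
     adjoin (base_field \<iota> \<S> w x y) (fst ` orbit \<iota> \<S> w x y \<union> snd ` orbit \<iota> \<S> w x y)"

definition group_x ::
    "(complex \<Rightarrow> 'k::field) \<Rightarrow> (int \<times> int) set \<Rightarrow> (int \<times> int \<Rightarrow> complex) \<Rightarrow> 'k \<Rightarrow> 'k \<Rightarrow> ('k \<Rightarrow> 'k) set" where
  "group_x \<iota> \<S> w x y = field_auts (orbit_field \<iota> \<S> w x y) (adjoin (base_field \<iota> \<S> w x y) {x})"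

definition group_y ::
    "(complex \<Rightarrow> 'k::field) \<Rightarrow> (int \<times> int) set \<Rightarrow> (int \<times> int \<Rightarrow> complex) \<Rightarrow> 'k \<Rightarrow> 'k \<Rightarrow> ('k \<Rightarrow> 'k) set" where
  "group_y \<iota> \<S> w x y = field_auts (orbit_field \<iota> \<S> w x y) (adjoin (base_field \<iota> \<S> w x y) {y})"


section \<open>Chains\<close>

type_synonym 'k chain = "('k \<times> 'k) \<Rightarrow>\<^sub>0 complex"

definition zero_chain ::
    "(complex \<Rightarrow> 'k::field) \<Rightarrow> (int \<times> int) set \<Rightarrow> (int \<times> int \<Rightarrow> complex) \<Rightarrow> 'k \<Rightarrow> 'k \<Rightarrow> 'k chain \<Rightarrow> bool" where
  "zero_chain \<iota> \<S> w x y \<gamma> \<longleftrightarrow> Poly_Mapping.keys \<gamma> \<subseteq> orbit \<iota> \<S> w x y"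

definition act :: "('k \<Rightarrow> 'k) \<Rightarrow> 'k chain \<Rightarrow> 'k chain" where
  "act \<sigma> \<gamma> = (\<Sum>p\<in>Poly_Mapping.keys \<gamma>.
     Poly_Mapping.single (map_prod \<sigma> \<sigma> p) (Poly_Mapping.lookup \<gamma> p))"

definition average :: "('k \<Rightarrow> 'k) set \<Rightarrow> 'k chain \<Rightarrow> 'k chain" where
  "average G \<gamma> = Poly_Mapping.map ((*) (1 / of_nat (card G))) (\<Sum>\<sigma>\<in>G. act \<sigma> \<gamma>)"

definition eval_chain ::
    "(complex \<Rightarrow> 'k::field) \<Rightarrow> (int \<times> int) set \<Rightarrow> (int \<times> int \<Rightarrow> complex) \<Rightarrow> 'k \<Rightarrow> 'k \<Rightarrow> fraction \<Rightarrow> 'k chain \<Rightarrow> 'k" where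
  "eval_chain \<iota> \<S> w x y H \<gamma> =
     (\<Sum>p\<in>Poly_Mapping.keys \<gamma>. \<iota> (Poly_Mapping.lookup \<gamma> p) *
        eval_fraction \<iota> H (fst p) (snd p) (1 / step_poly \<iota> \<S> w x y))"


section \<open>Decoupling\<close>

definition regular :: "(int \<times> int) set \<Rightarrow> (int \<times> int \<Rightarrow> complex) \<Rightarrow> fraction \<Rightarrow> bool" where
  "regular \<S> w H \<longleftrightarrow> \<not> kernel \<S> w dvd snd (quot_of_fract H)"

definition galois_decoupling :: "(int \<times> int) set \<Rightarrow> (int \<times> int \<Rightarrow> complex) \<Rightarrow> fraction \<Rightarrow> bool" where
  "galois_decoupling \<S> w H \<longleftrightarrow>
     (\<exists>F\<in>fractions_X_t. \<exists>E\<in>fractions_Y_t. \<exists>R. regular \<S> w R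
        \<and> H = F + E + to_fract (kernel \<S> w) * R)"

definition pseudo_decoupling ::
    "(complex \<Rightarrow> 'k::field) \<Rightarrow> (int \<times> int) set \<Rightarrow> (int \<times> int \<Rightarrow> complex) \<Rightarrow> 'k \<Rightarrow> 'k \<Rightarrow> 'k chain \<Rightarrow> 'k chain \<Rightarrow> bool" where
  "pseudo_decoupling \<iota> \<S> w x y \<gamma>\<^sub>x \<gamma>\<^sub>y \<longleftrightarrow>
     (\<forall>H. regular \<S> w H \<and> galois_decoupling \<S> w H \<longrightarrow>
        eval_chain \<iota> \<S> w x y H (Poly_Mapping.single (x, y) 1)
          = eval_chain \<iota> \<S> w x y H \<gamma>\<^sub>x + eval_chain \<iota> \<S> w x y H \<gamma>\<^sub>y
        \<and> eval_chain \<iota> \<S> w x y H \<gamma>\<^sub>x \<in> adjoin (base_field \<iota> \<S> w x y) {x}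
        \<and> eval_chain \<iota> \<S> w x y H \<gamma>\<^sub>y \<in> adjoin (base_field \<iota> \<S> w x y) {y})"

definition cancels_decoupled ::
    "(complex \<Rightarrow> 'k::field) \<Rightarrow> (int \<times> int) set \<Rightarrow> (int \<times> int \<Rightarrow> complex) \<Rightarrow> 'k \<Rightarrow> 'k \<Rightarrow> 'k chain \<Rightarrow> bool" where
  "cancels_decoupled \<iota> \<S> w x y \<alpha> \<longleftrightarrow>
     (\<forall>F\<in>fractions_X_t. \<forall>E\<in>fractions_Y_t. eval_chain \<iota> \<S> w x y (F + E) \<alpha> = 0)"

definition is_decoupling ::
    "(complex \<Rightarrow> 'k::field) \<Rightarrow> (int \<times> int) set \<Rightarrow> (int \<times> int \<Rightarrow> complex) \<Rightarrow> 'k \<Rightarrow> 'k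
     \<Rightarrow> 'k chain \<Rightarrow> 'k chain \<Rightarrow> 'k chain \<Rightarrow> bool" where
  "is_decoupling \<iota> \<S> w x y \<gamma>\<^sub>x \<gamma>\<^sub>y \<alpha> \<longleftrightarrow>
     zero_chain \<iota> \<S> w x y \<gamma>\<^sub>x \<and> zero_chain \<iota> \<S> w x y \<gamma>\<^sub>y \<and> zero_chain \<iota> \<S> w x y \<alpha>
     \<and> Poly_Mapping.single (x, y) 1 = \<gamma>\<^sub>x + \<gamma>\<^sub>y + \<alpha>
     \<and> (\<forall>\<sigma>\<in>group_x \<iota> \<S> w x y. act \<sigma> \<gamma>\<^sub>x = \<gamma>\<^sub>x)
     \<and> (\<forall>\<sigma>\<in>group_y \<iota> \<S> w x y. act \<sigma> \<gamma>\<^sub>y = \<gamma>\<^sub>y)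
     \<and> cancels_decoupled \<iota> \<S> w x y \<alpha>"

end

theory Submission
  imports Defs
begin

text \<open>A decoupled fraction \<open>H = F + E\<close> is its own Galois decoupling, so the pseudo-decoupling applies
  to it once \<open>H\<close> is known to be regular. For this, evaluate at \<open>(x, y, 1/S(x,y))\<close>, where the kernel
  vanishes: the denominators of \<open>F\<close> and \<open>E\<close> do not, since both \<open>(x, S(x,y))\<close> and \<open>(y, S(x,y))\<close> are
  algebraically independent. As \<open>H\<^sub>\<gamma>\<close> for \<open>\<gamma> = \<gamma>\<^sub>x\<close> lies in \<open>k(x)\<close>, it is fixed by \<open>G\<^sub>x\<close>, and evaluation
  commutes with automorphisms, so averaging \<open>\<gamma>\<^sub>x\<close> over \<open>G\<^sub>x\<close> does not change the value of \<open>H\<close>. The group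
  is finite because an automorphism is determined by its permutation of the finite orbit.\<close>

section \<open>Ring homomorphisms and evaluation\<close>

text \<open>Counterpart of \<open>field_embedding\<close> for commutative rings: the evaluations
  below start from polynomial rings, which are not fields.\<close>

definition is_ring_hom :: "('a::comm_ring_1 \<Rightarrow> 'b::comm_ring_1) \<Rightarrow> bool" where
  "is_ring_hom h \<longleftrightarrow>
     h 1 = 1 \<and> (\<forall>a b. h (a + b) = h a + h b) \<and> (\<forall>a b. h (a * b) = h a * h b)"

lemma is_ring_homD:
  assumes "is_ring_hom h"
  shows "h 0 = 0" "h 1 = 1" "h (a + b) = h a + h b" "h (a * b) = h a * h b"
    "h (- a) = - h a" "h (a - b) = h a - h b" "h (a ^ n) = h a ^ n"
    "h (\<Sum>i\<in>I. f i) = (\<Sum>i\<in>I. h (f i))"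
proof -
  show one: "h 1 = 1" and add: "\<And>a b. h (a + b) = h a + h b" and mult: "\<And>a b. h (a * b) = h a * h b"
    using assms by (auto simp: is_ring_hom_def)
  show zero: "h 0 = 0"
    using add[of 0 0] by simp
  show uminus: "h (- a) = - h a" for a
    using add[of a "- a"] zero by (simp add: eq_neg_iff_add_eq_0 add.commute)
  show "h (a - b) = h a - h b"
    using add[of a "- b"] uminus by simp
  show "h (a ^ n) = h a ^ n"
    by (induction n) (auto simp: one mult)
  show "h (\<Sum>i\<in>I. f i) = (\<Sum>i\<in>I. h (f i))"
    by (induction I rule: infinite_finite_induct) (auto simp: zero add)
qed

lemma field_embedding_is_ring_hom: "field_embedding \<iota> \<Longrightarrow> is_ring_hom \<iota>"
  by (simp add: field_embedding_def is_ring_hom_def)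

lemma is_ring_hom_map_poly:
  assumes "is_ring_hom h"
  shows "is_ring_hom (map_poly h)"
  unfolding is_ring_hom_def
proof (intro conjI allI poly_eqI)
  note hom = is_ring_homD[OF assms]
  show "coeff (map_poly h 1) n = coeff 1 n" for n
    using hom by (simp add: map_poly_1')
  show "coeff (map_poly h (p + q)) n = coeff (map_poly h p + map_poly h q) n" for p q n
    by (simp add: coeff_map_poly hom)
  show "coeff (map_poly h (p * q)) n = coeff (map_poly h p * map_poly h q) n" for p q n
    by (simp add: coeff_map_poly hom coeff_mult)
qed

lemma is_ring_hom_poly_map_poly:
  assumes "is_ring_hom h"
  shows "is_ring_hom (\<lambda>p. poly (map_poly h p) u)"
  using is_ring_hom_map_poly[OF assms] by (simp add: is_ring_hom_def)

lemma is_ring_hom_const_poly: "is_ring_hom (\<lambda>c. [:c:])"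
  by (simp add: is_ring_hom_def one_pCons)

lemma is_ring_hom_eval2:
  assumes "is_ring_hom \<iota>"
  shows "is_ring_hom (\<lambda>p. eval2 \<iota> p u v)"
  unfolding eval2_def
  by (intro is_ring_hom_poly_map_poly assms)

lemma is_ring_hom_eval3:
  assumes "is_ring_hom \<iota>"
  shows "is_ring_hom (\<lambda>p. eval3 \<iota> p u v s)"
  unfolding eval3_def
  by (intro is_ring_hom_poly_map_poly is_ring_hom_eval2 assms)

lemma poly_map_poly_monom:
  fixes h :: "'a::zero \<Rightarrow> 'b::comm_ring_1"
  shows "h 0 = 0 \<Longrightarrow> poly (map_poly h (monom c n)) u = h c * u ^ n"
  by (simp add: map_poly_monom poly_monom)

lemma eval2_monom:
  assumes "is_ring_hom \<iota>"
  shows "eval2 \<iota> (monom (monom c a) b) u v = \<iota> c * u ^ a * v ^ b"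
  using assms by (simp add: eval2_def poly_map_poly_monom is_ring_homD)

lemma eval3_monom3:
  assumes "is_ring_hom \<iota>"
  shows "eval3 \<iota> (monom3 c a b d) u v s = \<iota> c * u ^ a * v ^ b * s ^ d"
  using is_ring_homD(1)[OF is_ring_hom_eval2[OF assms]] assms
  by (simp add: eval3_def monom3_def poly_map_poly_monom eval2_monom)

text \<open>The free bound \<open>n\<close> gives polynomials of different degrees a common range of
  summation. It also absorbs a drop of degree under \<open>map_poly h\<close>, as \<open>h\<close>
  may kill the leading coefficient.\<close>

lemma poly_map_poly_altdef:
  fixes h :: "'a::zero \<Rightarrow> 'b::comm_ring_1"
  assumes h0: "h 0 = 0" and n: "degree p \<le> n"
  shows "poly (map_poly h p) u = (\<Sum>i\<le>n. h (coeff p i) * u ^ i)"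
proof -
  have "degree (map_poly h p) \<le> n"
    using n by (intro degree_le) (simp add: coeff_map_poly h0 coeff_eq_0)
  hence "poly (map_poly h p) u = (\<Sum>i\<le>n. coeff (map_poly h p) i * u ^ i)"
    unfolding poly_altdef by (intro sum.mono_neutral_left) (auto simp: coeff_eq_0)
  thus ?thesis by (simp add: coeff_map_poly h0)
qed

section \<open>Algebraic independence\<close>

lemma alg_independent2_swap:
  assumes hom: "is_ring_hom \<iota>" and indep: "alg_independent2 \<iota> x y"
  shows "alg_independent2 \<iota> y x"
  unfolding alg_independent2_def
proof (intro allI impI)
  fix p assume p0: "eval2 \<iota> p y x = 0"
  note h0 = is_ring_homD(1)[OF hom]
  define n where "n = degree p"
  \<comment> \<open>A common bound for the inner degrees turns \<open>p\<close> into a rectangular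
    array of coefficients, whose transpose is \<open>q\<close>.\<close>
  define m where "m = Max ((\<lambda>i. degree (coeff p i)) ` {..n})"
  have m: "degree (coeff p i) \<le> m" if "i \<le> n" for i
    unfolding m_def using that by (intro Max_ge) auto
  define q where "q = (\<Sum>i\<le>n. \<Sum>j\<le>m. monom (monom (coeff (coeff p i) j) i) j)"
  have "eval2 \<iota> p y x = (\<Sum>i\<le>n. poly (map_poly \<iota> (coeff p i)) y * x ^ i)"
    unfolding eval2_def by (rule poly_map_poly_altdef) (simp_all add: n_def)
  also have "\<dots> = (\<Sum>i\<le>n. \<Sum>j\<le>m. \<iota> (coeff (coeff p i) j) * y ^ j * x ^ i)"
    by (intro sum.cong refl)
      (simp add: poly_map_poly_altdef[where h = \<iota> and n = m] h0 m sum_distrib_right)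
  also have "\<dots> = eval2 \<iota> q x y"
    using hom by (simp add: q_def is_ring_homD(8)[OF is_ring_hom_eval2[OF hom]] eval2_monom mult_ac)
  finally have "q = 0"
    using indep p0 by (simp add: alg_independent2_def)
  \<comment> \<open>Inside the rectangle, entry (i, j) of \<open>p\<close> is entry (j, i) of
    \<open>q\<close>, hence zero; outside it the degree bounds apply.\<close>
  have "coeff (coeff p i) j = 0" for i j
  proof (cases "i \<le> n \<and> j \<le> m")
    case True
    have "0 = coeff (coeff q j) i" using \<open>q = 0\<close> by simp
    also have "\<dots> = (\<Sum>i'\<le>n. \<Sum>j'\<le>m. if j' = j then if i' = i then coeff (coeff p i') j' else 0 else 0)"
      unfolding q_def coeff_sum by (intro sum.cong refl) auto
    also have "\<dots> = coeff (coeff p i) j"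
      using True by (simp add: sum.delta)
    finally show ?thesis by simp
  next
    case False
    then show ?thesis
      using m by (metis coeff_0 coeff_eq_0 n_def not_le order.strict_trans1)
  qed
  thus "p = 0"
    by (intro poly_eqI) simp
qed

text \<open>Since \<open>degree Q < degree P\<close>, the degrees of the summands strictly decrease with \<open>i\<close>, so that
  the first nonvanishing one cannot be cancelled.\<close>

lemma homogenization_nonzero:
  fixes P Q :: "'a::idom poly"
  assumes deg: "degree Q < degree P" and "Q \<noteq> 0" "p \<noteq> 0"
  shows "(\<Sum>i\<le>degree p. smult (coeff p i) (Q ^ i * P ^ (degree p - i))) \<noteq> 0" (is "?S \<noteq> 0")
proof -
  define n where "n = degree p"
  define T where "T = (\<lambda>i. smult (coeff p i) (Q ^ i * P ^ (n - i)))"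
  define i0 where "i0 = (LEAST i. coeff p i \<noteq> 0)"
  have i0: "coeff p i0 \<noteq> 0"
    unfolding i0_def by (rule LeastI[of _ "degree p"]) (use \<open>p \<noteq> 0\<close> in simp)
  have below: "coeff p i = 0" if "i < i0" for i
    using not_less_Least that unfolding i0_def by blast
  have "i0 \<le> n" using i0 by (simp add: n_def le_degree)
  have "P \<noteq> 0" using deg by auto
  have deg_le: "degree (T i) \<le> i * degree Q + (n - i) * degree P" for i
    unfolding T_def
    by (rule order.trans[OF degree_smult_le])
      (simp add: degree_mult_eq degree_power_eq \<open>P \<noteq> 0\<close> \<open>Q \<noteq> 0\<close>)
  have deg_i0: "degree (T i0) = i0 * degree Q + (n - i0) * degree P"
    using i0 by (simp add: T_def degree_mult_eq degree_power_eq \<open>P \<noteq> 0\<close> \<open>Q \<noteq> 0\<close>)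
  have smaller: "degree (T i) < degree (T i0)" if "i0 < i" "i \<le> n" for i
  proof -
    obtain k where k: "i = i0 + k" "k > 0" using \<open>i0 < i\<close> less_imp_add_positive by blast
    obtain l where l: "n = i + l" using \<open>i \<le> n\<close> le_Suc_ex by blast
    have "k * degree Q < k * degree P" using k deg by simp
    moreover have "degree (T i) \<le> i0 * degree Q + k * degree Q + l * degree P"
      using deg_le[of i] by (simp add: l k add_mult_distrib)
    moreover have "degree (T i0) = i0 * degree Q + k * degree P + l * degree P"
      using deg_i0 by (simp add: l k add_mult_distrib)
    ultimately show ?thesis by linarith
  qed
  have "coeff (T i) (degree (T i0)) = 0" if "i \<in> {..n} - {i0}" for i
    using that smaller[of i] below[of i]
    by (cases "i < i0") (auto simp: T_def intro: coeff_eq_0)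
  hence "coeff (\<Sum>i\<le>n. T i) (degree (T i0)) = lead_coeff (T i0)"
    unfolding coeff_sum using \<open>i0 \<le> n\<close> by (subst sum.remove[of _ i0]) auto
  moreover have "T i0 \<noteq> 0"
    using i0 by (simp add: T_def \<open>P \<noteq> 0\<close> \<open>Q \<noteq> 0\<close>)
  ultimately show ?thesis
    by (auto simp: T_def n_def)
qed

section \<open>The step polynomial as a quotient of polynomials, and its independence from each
  coordinate\<close>

definition step_denominator :: "(int \<times> int) set \<Rightarrow> complex poly poly" where
  "step_denominator \<S> = monom (monom 1 (nat (- Min (fst ` \<S>)))) (nat (- Min (snd ` \<S>)))"

text \<open>This is the Laurent polynomial S multiplied by \<open>step_denominator\<close>.
  Subtracting the minimal exponents makes every exponent nonnegative, so \<open>nat\<close> loses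
  nothing.\<close>

definition step_numerator ::
    "(int \<times> int) set \<Rightarrow> (int \<times> int \<Rightarrow> complex) \<Rightarrow> complex poly poly" where
  "step_numerator \<S> w =
     (\<Sum>(i, j)\<in>\<S>. monom (monom (w (i, j)) (nat (i - Min (fst ` \<S>)))) (nat (j - Min (snd ` \<S>))))"

lemma degree_step_denominator_less:
  assumes "weighted_steps \<S> w"
  shows "degree (step_denominator \<S>) < degree (step_numerator \<S> w)"
proof -
  define a b where "a = Min (fst ` \<S>)" and "b = Min (snd ` \<S>)"
  have fin: "finite \<S>" and ne: "\<S> \<noteq> {}" and "b < 0" and "Max (snd ` \<S>) > 0"
    and wnz: "\<And>s. s \<in> \<S> \<Longrightarrow> w s \<noteq> 0"
    using assms by (auto simp: weighted_steps_def a_def b_def)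
  have "Max (snd ` \<S>) \<in> snd ` \<S>" using fin ne by (intro Max_in) auto
  with \<open>Max (snd ` \<S>) > 0\<close> obtain i0 j0 where ij0: "(i0, j0) \<in> \<S>" "j0 > 0" by force
  have ge: "a \<le> i" "b \<le> j" if "(i, j) \<in> \<S>" for i j
    using that fin unfolding a_def b_def by (auto intro!: Min_le simp: rev_image_eqI)
  \<comment> \<open>Shifting by (a, b) is injective on the steps, so a single step contributes to
    this coefficient and nothing can cancel it.\<close>
  have "coeff (coeff (step_numerator \<S> w) (nat (j0 - b))) (nat (i0 - a))
      = (\<Sum>s\<in>\<S>. if s = (i0, j0) then w s else 0)"
    unfolding step_numerator_def coeff_sum a_def[symmetric] b_def[symmetric]
    using ge ge[OF ij0(1)]
    by (intro sum.cong refl) (auto simp: case_prod_unfold nat_eq_iff prod_eq_iff)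
  also have "\<dots> \<noteq> 0" using fin ij0 wnz by simp
  finally have "nat (j0 - b) \<le> degree (step_numerator \<S> w)"
    by (intro le_degree) auto
  moreover have "degree (step_denominator \<S>) = nat (- b)"
    by (simp add: step_denominator_def b_def degree_monom_eq)
  ultimately show ?thesis using ij0 \<open>b < 0\<close> by linarith
qed

lemma alg_independent2_nonzero:
  assumes hom: "is_ring_hom \<iota>" and indep: "alg_independent2 \<iota> x y"
  shows "x \<noteq> 0" "y \<noteq> 0"
proof -
  have "eval2 \<iota> (monom (monom 1 1) 0) x y = x" "eval2 \<iota> (monom (monom 1 0) 1) x y = y"
    by (simp_all only: eval2_monom[OF hom] is_ring_homD(2)[OF hom]) simp_all
  thus "x \<noteq> 0" "y \<noteq> 0"
    using indep unfolding alg_independent2_def by (metis monom_eq_0_iff one_neq_zero)+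
qed

lemma eval2_step_denominator:
  assumes "is_ring_hom \<iota>"
  shows "eval2 \<iota> (step_denominator \<S>) u v = u ^ nat (- Min (fst ` \<S>)) * v ^ nat (- Min (snd ` \<S>))"
  using assms by (simp add: step_denominator_def eval2_monom is_ring_homD)

lemma power_int_mult_power_nat:
  fixes u :: "'a::field"
  assumes "u \<noteq> 0" "a \<le> 0" "a \<le> i"
  shows "u powi i * u ^ nat (- a) = u ^ nat (i - a)"
proof -
  have "u powi i * u ^ nat (- a) = u powi i * u powi (- a)"
    using assms by (simp add: power_int_def)
  also have "\<dots> = u powi (i - a)" using assms by (simp flip: power_int_add)
  also have "\<dots> = u ^ nat (i - a)" using assms by (simp add: power_int_def)
  finally show ?thesis .
qed

lemma eval2_step_numerator:
  assumes hom: "is_ring_hom \<iota>" and ws: "weighted_steps \<S> w" and nz: "u \<noteq> 0" "v \<noteq> 0"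
  shows "eval2 \<iota> (step_numerator \<S> w) u v
    = step_poly \<iota> \<S> w u v * eval2 \<iota> (step_denominator \<S>) u v"
proof -
  define a b where "a = Min (fst ` \<S>)" and "b = Min (snd ` \<S>)"
  have fin: "finite \<S>" and neg: "a \<le> 0" "b \<le> 0"
    using ws by (auto simp: weighted_steps_def a_def b_def)
  have ge: "a \<le> i" "b \<le> j" if "(i, j) \<in> \<S>" for i j
    using that fin unfolding a_def b_def by (auto intro!: Min_le simp: rev_image_eqI)
  have "\<iota> (w (i, j)) * u ^ nat (i - a) * v ^ nat (j - b)
      = \<iota> (w (i, j)) * u powi i * v powi j * (u ^ nat (- a) * v ^ nat (- b))"
    if "(i, j) \<in> \<S>" for i j
    unfolding power_int_mult_power_nat[OF nz(1) neg(1) ge(1)[OF that], symmetric]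
      power_int_mult_power_nat[OF nz(2) neg(2) ge(2)[OF that], symmetric]
    by (simp only: mult_ac)
  thus ?thesis
    unfolding step_numerator_def step_poly_def eval2_step_denominator[OF hom]
      is_ring_homD(8)[OF is_ring_hom_eval2[OF hom]] sum_distrib_right a_def[symmetric] b_def[symmetric]
    by (intro sum.cong refl) (auto simp: eval2_monom[OF hom])
qed

text \<open>With P and Q the numerator and denominator of S, the value s = 1/S(x,y) is Q/P at (x,y).
  A relation p(x,s) = 0 of degree n in s, multiplied by the n-th power of P(x,y), becomes a
  polynomial relation between x and y. Their independence makes that polynomial zero, which
  \<open>homogenization_nonzero\<close> forbids unless p = 0.\<close>

lemma step_poly_transcendental:
  assumes hom: "is_ring_hom \<iota>" and indep: "alg_independent2 \<iota> x y" and ws: "weighted_steps \<S> w"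
  shows "step_poly \<iota> \<S> w x y \<noteq> 0"
    and "alg_independent2 \<iota> x (1 / step_poly \<iota> \<S> w x y)"
proof -
  define P Q s where "P = step_numerator \<S> w" and "Q = step_denominator \<S>"
    and "s = 1 / step_poly \<iota> \<S> w x y"
  let ?e = "\<lambda>p. eval2 \<iota> p x y"
  note e = is_ring_homD[OF is_ring_hom_eval2[OF hom, of x y]]
  note nz = alg_independent2_nonzero[OF hom indep]
  have deg: "degree Q < degree P"
    using degree_step_denominator_less[OF ws] by (simp add: P_def Q_def)
  have e0: "p = 0" if "?e p = 0" for p
    using indep that by (simp add: alg_independent2_def)
  have "P \<noteq> 0" using deg by auto
  have "Q \<noteq> 0" by (simp add: Q_def step_denominator_def monom_eq_0_iff)
  have P: "?e P = step_poly \<iota> \<S> w x y * ?e Q"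
    unfolding P_def Q_def by (rule eval2_step_numerator[OF hom ws nz])
  show S0: "step_poly \<iota> \<S> w x y \<noteq> 0"
    using P e0[of P] \<open>P \<noteq> 0\<close> by auto
  have Q: "?e Q = s * ?e P"
    using P S0 by (simp add: s_def)
  show "alg_independent2 \<iota> x (1 / step_poly \<iota> \<S> w x y)"
    unfolding alg_independent2_def s_def[symmetric]
  proof (intro allI impI)
    fix p assume p: "eval2 \<iota> p x s = 0"
    let ?n = "degree p"
    \<comment> \<open>As a product with a polynomial constant in Y, a scalar multiple is accessible
      to the homomorphism rules; the constant \<open>[:c:]\<close> evaluates to c(x).\<close>
    have smult_as_const_mult: "smult c q = [:c:] * q" for c and q :: "complex poly poly"
      by simp
    have "?e (\<Sum>i\<le>?n. smult (coeff p i) (Q ^ i * P ^ (?n - i)))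
        = (\<Sum>i\<le>?n. ?e [:coeff p i:] * (?e Q ^ i * ?e P ^ (?n - i)))"
      unfolding smult_as_const_mult e ..
    also have "\<dots> = (\<Sum>i\<le>?n. poly (map_poly \<iota> (coeff p i)) x * s ^ i * ?e P ^ ?n)"
    proof (intro sum.cong refl)
      fix i assume "i \<in> {..?n}"
      hence "?e P ^ ?n = ?e P ^ i * ?e P ^ (?n - i)" by (simp flip: power_add)
      moreover have "?e [:coeff p i:] = poly (map_poly \<iota> (coeff p i)) x"
        by (simp add: eval2_def map_poly_pCons)
      ultimately show "?e [:coeff p i:] * (?e Q ^ i * ?e P ^ (?n - i))
          = poly (map_poly \<iota> (coeff p i)) x * s ^ i * ?e P ^ ?n"
        by (simp add: Q power_mult_distrib mult_ac)
    qed
    also have "\<dots> = eval2 \<iota> p x s * ?e P ^ ?n"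
      unfolding eval2_def by (subst poly_map_poly_altdef[of _ p ?n]) (simp_all add: sum_distrib_right)
    finally have "(\<Sum>i\<le>?n. smult (coeff p i) (Q ^ i * P ^ (?n - i))) = 0"
      using p e0 by simp
    thus "p = 0"
      using homogenization_nonzero[OF deg \<open>Q \<noteq> 0\<close>] by blast
  qed
qed

lemma step_poly_swap:
  "step_poly \<iota> (prod.swap ` \<S>) (w \<circ> prod.swap) v u = step_poly \<iota> \<S> w u v"
  unfolding step_poly_def
  by (subst sum.reindex) (auto simp: case_prod_unfold mult_ac)

lemma weighted_steps_swap:
  assumes "weighted_steps \<S> w"
  shows "weighted_steps (prod.swap ` \<S>) (w \<circ> prod.swap)"
proof -
  have "fst ` prod.swap ` \<S> = snd ` \<S>" "snd ` prod.swap ` \<S> = fst ` \<S>"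
    by (simp_all add: image_image)
  thus ?thesis
    using assms unfolding weighted_steps_def neg_0_less_iff_less by simp
qed

text \<open>Reflecting the step set in the diagonal exchanges the roles of x and y, and
  \<open>alg_independent2\<close> is symmetric, so the result for x carries over.\<close>

lemma step_poly_transcendental':
  assumes hom: "is_ring_hom \<iota>" and indep: "alg_independent2 \<iota> x y" and ws: "weighted_steps \<S> w"
  shows "alg_independent2 \<iota> y (1 / step_poly \<iota> \<S> w x y)"
  using step_poly_transcendental(2)[OF hom alg_independent2_swap[OF hom indep] weighted_steps_swap[OF ws]]
  by (simp add: step_poly_swap)

section \<open>Regularity of decoupled fractions\<close>

text \<open>The kernel is \<open>step_denominator\<close> minus t times
  \<open>step_numerator\<close>. At t = 1/S(u,v) the two terms cancel, because the numerator has
  S(u,v) times the value of the denominator.\<close>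

lemma eval3_kernel:
  assumes hom: "is_ring_hom \<iota>" and ws: "weighted_steps \<S> w" and nz: "u \<noteq> 0" "v \<noteq> 0"
    and S0: "step_poly \<iota> \<S> w u v \<noteq> 0"
  shows "eval3 \<iota> (kernel \<S> w) u v (1 / step_poly \<iota> \<S> w u v) = 0"
proof -
  let ?s = "1 / step_poly \<iota> \<S> w u v"
  note e = is_ring_homD[OF is_ring_hom_eval3[OF hom, of u v ?s]]
  have "eval3 \<iota> (kernel \<S> w) u v ?s
      = eval2 \<iota> (step_denominator \<S>) u v - eval2 \<iota> (step_numerator \<S> w) u v * ?s"
    unfolding kernel_def Let_def e step_numerator_def step_denominator_def
      is_ring_homD(8)[OF is_ring_hom_eval2[OF hom]] sum_distrib_right
    by (intro arg_cong2[where f = minus] sum.cong refl)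
      (auto simp: eval3_monom3[OF hom] eval2_monom[OF hom])
  thus ?thesis
    using S0 by (simp add: eval2_step_numerator[OF hom ws nz])
qed

section \<open>Fractions in two of the three variables\<close>

lemma is_subfield_fractions_of_subring:
  fixes \<phi> :: "'a::idom \<Rightarrow> 'b::idom"
  assumes hom: "is_ring_hom \<phi>" and inj: "\<And>a. \<phi> a = 0 \<Longrightarrow> a = 0"
  shows "is_subfield {Fract (\<phi> a) (\<phi> b) | a b. b \<noteq> 0}" (is "is_subfield ?Q")
proof -
  note h = is_ring_homD[OF hom]
  have nz: "\<phi> b \<noteq> 0" if "b \<noteq> 0" for b using inj that by blast
  have I: "z \<in> ?Q" if "z = Fract (\<phi> a) (\<phi> b)" "b \<noteq> 0" for z a b
    using that by blast
  show ?thesis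
    unfolding is_subfield_def
  proof (intro conjI ballI)
    show "0 \<in> ?Q" by (rule I[of _ 0 1]) (simp_all add: h Zero_fract_def)
    show "1 \<in> ?Q" by (rule I[of _ 1 1]) (simp_all add: h One_fract_def)
  next
    fix p q assume "p \<in> ?Q" "q \<in> ?Q"
    then obtain a b c d where pq: "p = Fract (\<phi> a) (\<phi> b)" "b \<noteq> 0" "q = Fract (\<phi> c) (\<phi> d)" "d \<noteq> 0"
      by blast
    show "p + q \<in> ?Q"
      by (rule I[of _ "a * d + c * b" "b * d"]) (use pq in \<open>simp_all add: h nz\<close>)
    show "p * q \<in> ?Q"
      by (rule I[of _ "a * c" "b * d"]) (use pq in \<open>simp_all add: h nz\<close>)
  next
    fix p assume "p \<in> ?Q"
    then obtain a b where p: "p = Fract (\<phi> a) (\<phi> b)" "b \<noteq> 0" by blast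
    show "- p \<in> ?Q"
      by (rule I[of _ "- a" b]) (use p in \<open>simp_all add: h\<close>)
    show "inverse p \<in> ?Q"
    proof (cases "a = 0")
      case True
      \<comment> \<open>Here \<open>Fract b a\<close> would have a zero denominator; since inverse 0
        = 0, the representation 0/1 is used instead.\<close>
      show ?thesis
        by (rule I[of _ 0 1]) (use p True in \<open>simp_all add: h fract_collapse nz\<close>)
    next
      case False
      show ?thesis
        by (rule I[of _ b a]) (use p False in \<open>simp_all\<close>)
    qed
  qed
qed

text \<open>The hull gives no numerators or denominators by itself. Minimality supplies them: the
  fractions over the image of the subring already form a subfield containing all generators.\<close>

lemma adjoin_subset_fractions_of_subring:
  fixes \<phi> :: "'a::idom \<Rightarrow> 'b::idom"
  assumes hom: "is_ring_hom \<phi>" and inj: "\<And>a. \<phi> a = 0 \<Longrightarrow> a = 0"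
    and gens: "A \<union> B \<subseteq> to_fract ` range \<phi>"
  shows "adjoin A B \<subseteq> {Fract (\<phi> a) (\<phi> b) | a b. b \<noteq> 0}"
  unfolding adjoin_def
proof (rule hull_minimal)
  show "is_subfield {Fract (\<phi> a) (\<phi> b) | a b. b \<noteq> 0}"
    by (rule is_subfield_fractions_of_subring[OF hom]) (rule inj)
  show "A \<union> B \<subseteq> {Fract (\<phi> a) (\<phi> b) | a b. b \<noteq> 0}"
  proof
    fix z assume "z \<in> A \<union> B"
    then obtain a where "z = to_fract (\<phi> a)" using gens by auto
    hence "z = Fract (\<phi> a) (\<phi> 1) \<and> (1::'a) \<noteq> 0"
      by (simp add: to_fract_def is_ring_homD(2)[OF hom])
    thus "z \<in> {Fract (\<phi> a) (\<phi> b) | a b. b \<noteq> 0}" by blast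
  qed
qed

text \<open>The type \<open>complex poly poly\<close> is read here as C[X,t], with t outermost; each
  coefficient in C[X] becomes a polynomial constant in Y.\<close>

definition embed_X_t :: "complex poly poly \<Rightarrow> complex poly poly poly" where
  "embed_X_t = map_poly (\<lambda>q. [:q:])"

text \<open>The same type is now read as C[Y,t], and it is the scalars at the innermost level that
  become polynomials constant in X.\<close>

definition embed_Y_t :: "complex poly poly \<Rightarrow> complex poly poly poly" where
  "embed_Y_t = map_poly (map_poly (\<lambda>c. [:c:]))"

lemma is_ring_hom_embed: "is_ring_hom embed_X_t" "is_ring_hom embed_Y_t"
  unfolding embed_X_t_def embed_Y_t_def
  by (intro is_ring_hom_map_poly is_ring_hom_const_poly)+

lemma eval3_embed:
  assumes hom: "is_ring_hom \<iota>"
  shows "eval3 \<iota> (embed_X_t p) u v s = eval2 \<iota> p u s"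
    and "eval3 \<iota> (embed_Y_t p) u v s = eval2 \<iota> p v s"
proof -
  have "eval2 \<iota> [:q:] u v = poly (map_poly \<iota> q) u" for q
    by (simp add: eval2_def map_poly_pCons)
  thus "eval3 \<iota> (embed_X_t p) u v s = eval2 \<iota> p u s"
    by (simp add: eval3_def embed_X_t_def map_poly_map_poly o_def eval2_def)
  have "eval2 \<iota> (map_poly (\<lambda>c. [:c:]) q) u v = poly (map_poly \<iota> q) v" for q
    using is_ring_homD(1)[OF hom]
    by (simp add: eval2_def map_poly_map_poly o_def map_poly_pCons)
  thus "eval3 \<iota> (embed_Y_t p) u v s = eval2 \<iota> p v s"
    using is_ring_homD(1)[OF is_ring_hom_eval2[OF hom]]
    by (simp add: eval3_def embed_Y_t_def map_poly_map_poly o_def eval2_def[of \<iota> p])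
qed

lemma embed_eq_0: "embed_X_t p = 0 \<Longrightarrow> p = 0" "embed_Y_t p = 0 \<Longrightarrow> p = 0"
  by (simp_all add: embed_X_t_def embed_Y_t_def map_poly_eq_0_iff)

lemma monom3_eq_embed:
  "monom3 c a 0 d = embed_X_t (monom (monom c a) d)"
  "monom3 c 0 b d = embed_Y_t (monom (monom c b) d)"
  by (simp_all add: monom3_def embed_X_t_def embed_Y_t_def map_poly_monom monom_0)

lemma fractions_X_t_subset: "fractions_X_t \<subseteq> {Fract (embed_X_t a) (embed_X_t b) | a b. b \<noteq> 0}"
  unfolding fractions_X_t_def constants_def
  by (intro adjoin_subset_fractions_of_subring is_ring_hom_embed embed_eq_0)
    (auto simp: monom3_eq_embed)

lemma fractions_Y_t_subset: "fractions_Y_t \<subseteq> {Fract (embed_Y_t a) (embed_Y_t b) | a b. b \<noteq> 0}"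
  unfolding fractions_Y_t_def constants_def
  by (intro adjoin_subset_fractions_of_subring is_ring_hom_embed embed_eq_0)
    (auto simp: monom3_eq_embed(2))

text \<open>Regularity concerns the reduced denominator, whereas usually just some denominator is
  known. If a/b is the reduced form, then a d = n b with a and b coprime, so b divides d.\<close>

lemma snd_quot_of_fract_dvd:
  assumes "d \<noteq> 0"
  shows "snd (quot_of_fract (Fract n d)) dvd d"
proof -
  obtain a b where ab: "quot_of_fract (Fract n d) = (a, b)" by fastforce
  have "Fract a b = Fract n d" "b \<noteq> 0"
    using Fract_quot_of_fract[of "Fract n d"] snd_quot_of_fract_nonzero[of "Fract n d"] ab by auto
  hence "a * d = n * b" using assms by (simp add: eq_fract)
  moreover have "coprime a b"
    using quot_of_fract_in_normalized_fracts[of "Fract n d"] ab by (simp add: normalized_fracts_def)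
  ultimately have "b dvd d"
    by (metis coprime_commute coprime_dvd_mult_right_iff dvd_triv_right)
  thus ?thesis by (simp add: ab)
qed

lemma regular_decoupled:
  assumes hom: "is_ring_hom \<iota>" and indep: "alg_independent2 \<iota> x y" and ws: "weighted_steps \<S> w"
    and F: "F \<in> fractions_X_t" and E: "E \<in> fractions_Y_t"
  shows "regular \<S> w (F + E)"
proof -
  define s where "s = 1 / step_poly \<iota> \<S> w x y"
  let ?e = "\<lambda>p. eval3 \<iota> p x y s"
  note e = is_ring_homD[OF is_ring_hom_eval3[OF hom, of x y s]]
  obtain a b c d where F: "F = Fract (embed_X_t a) (embed_X_t b)" "b \<noteq> 0"
    and E: "E = Fract (embed_Y_t c) (embed_Y_t d)" "d \<noteq> 0"
    using F E fractions_X_t_subset fractions_Y_t_subset by blast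
  let ?D = "embed_X_t b * embed_Y_t d"
  \<comment> \<open>The factors evaluate to b(x,s) and d(y,s), which are nonzero by the independence
    of (x,s) and of (y,s) respectively.\<close>
  have "?e ?D \<noteq> 0"
    using step_poly_transcendental(2)[OF hom indep ws] step_poly_transcendental'[OF hom indep ws] F E
    unfolding e eval3_embed[OF hom] alg_independent2_def s_def[symmetric] by auto
  hence D0: "?D \<noteq> 0" using e(1) by metis
  have "F + E = Fract (embed_X_t a * embed_Y_t d + embed_Y_t c * embed_X_t b) ?D"
    using D0 F E by simp
  hence "snd (quot_of_fract (F + E)) dvd ?D"
    using snd_quot_of_fract_dvd[OF D0] by simp
  moreover have "?e (kernel \<S> w) = 0"
    unfolding s_def using step_poly_transcendental(1)[OF hom indep ws]
    by (intro eval3_kernel hom ws alg_independent2_nonzero[OF hom indep])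
  \<comment> \<open>If the kernel divided the reduced denominator, it would divide
    \<open>?D\<close>, whose value would then be zero.\<close>
  ultimately show ?thesis
    using \<open>?e ?D \<noteq> 0\<close> unfolding regular_def by (metis dvd_trans dvdE e(4) mult_zero_left)
qed

text \<open>The remainder R is taken to be 0, so the regularity assumption concerns the fraction 0,
  which is regular exactly when the kernel does not divide 1.\<close>

lemma galois_decoupling_decoupled:
  assumes ker: "regular \<S> w 0" and "F \<in> fractions_X_t" "E \<in> fractions_Y_t"
  shows "galois_decoupling \<S> w (F + E)"
  unfolding galois_decoupling_def using assms by (metis add.right_neutral mult_zero_right)

section \<open>Subfields and their automorphisms\<close>

lemma is_subfield_adjoin: "is_subfield (adjoin F A)"
  unfolding adjoin_def by (rule hull_in) (auto simp: is_subfield_def)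

lemma adjoin_superset: "F \<subseteq> adjoin F A" "A \<subseteq> adjoin F A"
  using hull_subset[of "F \<union> A" is_subfield] by (auto simp: adjoin_def)

lemma adjoin_minimal: "is_subfield K \<Longrightarrow> F \<subseteq> K \<Longrightarrow> A \<subseteq> K \<Longrightarrow> adjoin F A \<subseteq> K"
  unfolding adjoin_def by (rule hull_minimal) auto

lemma is_subfieldD:
  assumes "is_subfield L"
  shows "0 \<in> L" "1 \<in> L" "a \<in> L \<Longrightarrow> b \<in> L \<Longrightarrow> a + b \<in> L" "a \<in> L \<Longrightarrow> b \<in> L \<Longrightarrow> a * b \<in> L"
    "a \<in> L \<Longrightarrow> inverse a \<in> L" "a \<in> L \<Longrightarrow> b \<in> L \<Longrightarrow> a / b \<in> L"
    "a \<in> L \<Longrightarrow> a ^ n \<in> L" "a \<in> L \<Longrightarrow> a powi i \<in> L" "(\<And>i. i \<in> I \<Longrightarrow> f i \<in> L) \<Longrightarrow> sum f I \<in> L"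
proof -
  show [simp]: "0 \<in> L" "1 \<in> L" and [simp]: "\<And>a b. a \<in> L \<Longrightarrow> b \<in> L \<Longrightarrow> a + b \<in> L"
    "\<And>a b. a \<in> L \<Longrightarrow> b \<in> L \<Longrightarrow> a * b \<in> L" "\<And>a. a \<in> L \<Longrightarrow> inverse a \<in> L"
    using assms by (auto simp: is_subfield_def)
  thus "a \<in> L \<Longrightarrow> b \<in> L \<Longrightarrow> a / b \<in> L" by (simp add: divide_inverse)
  show pow: "a ^ n \<in> L" if "a \<in> L" for a n using that by (induction n) auto
  thus "a \<in> L \<Longrightarrow> a powi i \<in> L" by (simp add: power_int_def)
  show "(\<And>i. i \<in> I \<Longrightarrow> f i \<in> L) \<Longrightarrow> sum f I \<in> L"
    by (induction I rule: infinite_finite_induct) auto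
qed

text \<open>The definition asks for bijectivity, additivity and multiplicativity on L. The value at
  1 is idempotent and, by injectivity, nonzero, hence 1; inverses follow, including inverse 0 =
  0.\<close>

lemma field_autsD:
  assumes L: "is_subfield L" and \<sigma>: "\<sigma> \<in> field_auts L F"
  shows "bij_betw \<sigma> L L" "a \<in> L \<Longrightarrow> \<sigma> a \<in> L" "a \<in> F \<Longrightarrow> \<sigma> a = a" "\<sigma> \<in> extensional L"
    "a \<in> L \<Longrightarrow> b \<in> L \<Longrightarrow> \<sigma> (a + b) = \<sigma> a + \<sigma> b"
    "a \<in> L \<Longrightarrow> b \<in> L \<Longrightarrow> \<sigma> (a * b) = \<sigma> a * \<sigma> b"
    "\<sigma> 0 = 0" "\<sigma> 1 = 1" "a \<in> L \<Longrightarrow> \<sigma> (- a) = - \<sigma> a"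
    "a \<in> L \<Longrightarrow> \<sigma> (inverse a) = inverse (\<sigma> a)"
    "a \<in> L \<Longrightarrow> b \<in> L \<Longrightarrow> \<sigma> (a / b) = \<sigma> a / \<sigma> b"
    "a \<in> L \<Longrightarrow> \<sigma> a = 0 \<longleftrightarrow> a = 0"
    "a \<in> L \<Longrightarrow> \<sigma> (a powi i) = \<sigma> a powi i"
    "(\<And>i. i \<in> I \<Longrightarrow> f i \<in> L) \<Longrightarrow> \<sigma> (sum f I) = (\<Sum>i\<in>I. \<sigma> (f i))"
proof -
  note K = is_subfieldD[OF L]
  show bij: "bij_betw \<sigma> L L" and "a \<in> F \<Longrightarrow> \<sigma> a = a" "\<sigma> \<in> extensional L"
    and add: "\<And>a b. a \<in> L \<Longrightarrow> b \<in> L \<Longrightarrow> \<sigma> (a + b) = \<sigma> a + \<sigma> b"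
    and mult: "\<And>a b. a \<in> L \<Longrightarrow> b \<in> L \<Longrightarrow> \<sigma> (a * b) = \<sigma> a * \<sigma> b"
    using \<sigma> by (auto simp: field_auts_def)
  show "a \<in> L \<Longrightarrow> \<sigma> a \<in> L" using bij by (rule bij_betw_apply)
  show zero: "\<sigma> 0 = 0" using add[of 0 0] K(1) by (metis add.right_neutral add_left_cancel)
  show eq0: "\<sigma> a = 0 \<longleftrightarrow> a = 0" if "a \<in> L" for a
    using bij that K(1) zero by (metis bij_betw_imp_inj_on inj_onD)
  show one: "\<sigma> 1 = 1" using mult[of 1 1] eq0[of 1] K by simp
  show "\<sigma> (- a) = - \<sigma> a" if "a \<in> L"
  proof -
    have "- a \<in> L" using that L by (auto simp: is_subfield_def)
    thus ?thesis using add[of a "- a"] that zero by (simp add: eq_neg_iff_add_eq_0 add.commute)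
  qed
  show inv: "\<sigma> (inverse a) = inverse (\<sigma> a)" if "a \<in> L" for a
  proof (cases "a = 0")
    case False
    hence "\<sigma> a * \<sigma> (inverse a) = 1" using that K mult[of a "inverse a"] one by simp
    thus ?thesis by (metis inverse_unique)
  qed (simp add: zero)
  show "\<sigma> (a / b) = \<sigma> a / \<sigma> b" if "a \<in> L" "b \<in> L"
    using that K mult inv by (simp add: divide_inverse)
  have pow: "\<sigma> (a ^ n) = \<sigma> a ^ n" if "a \<in> L" for a n
    using that by (induction n) (auto simp: one mult K)
  show "\<sigma> (a powi i) = \<sigma> a powi i" if "a \<in> L"
    using that by (simp add: power_int_def pow inv K)
  show "(\<And>i. i \<in> I \<Longrightarrow> f i \<in> L) \<Longrightarrow> \<sigma> (sum f I) = (\<Sum>i\<in>I. \<sigma> (f i))"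
    by (induction I rule: infinite_finite_induct) (auto simp: zero add K)
qed

text \<open>Using \<open>compose L\<close> instead of plain composition keeps the product
  extensional, as membership in \<open>field_auts\<close> requires.\<close>

lemma field_auts_compose:
  assumes L: "is_subfield L" and FL: "F \<subseteq> L" and \<sigma>: "\<sigma> \<in> field_auts L F" and \<tau>: "\<tau> \<in> field_auts L F"
  shows "compose L \<sigma> \<tau> \<in> field_auts L F"
proof -
  note s = field_autsD[OF L \<sigma>] and t = field_autsD[OF L \<tau>]
  have "bij_betw (compose L \<sigma> \<tau>) L L"
    using t(1) s(1) by (rule bij_betw_compose)
  thus ?thesis
    using FL by (auto simp: field_auts_def compose_def is_subfieldD[OF L] s t subset_iff)
qed

lemma field_auts_id:
  assumes L: "is_subfield L" and FL: "F \<subseteq> L"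
  shows "restrict id L \<in> field_auts L F"
  using FL is_subfieldD[OF L] by (auto simp: field_auts_def bij_betw_def inj_on_def)

text \<open>One level of nested evaluation, to be applied for X, Y and t in turn. The maps
  \<open>f\<close> and \<open>g\<close> evaluate the coefficients before and after \<sigma> has
  moved the inner variables; at the innermost level both are the embedding of constants.\<close>

lemma aut_poly_map_poly:
  assumes L: "is_subfield L" and \<sigma>: "\<sigma> \<in> field_auts L F" and u: "u \<in> L"
    and f: "f 0 = 0" "\<And>c. f c \<in> L" and g: "g 0 = 0" "\<And>c. \<sigma> (f c) = g c"
  shows "poly (map_poly f p) u \<in> L" "\<sigma> (poly (map_poly f p) u) = poly (map_poly g p) (\<sigma> u)"
proof -
  note s = field_autsD[OF L \<sigma>] and K = is_subfieldD[OF L]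
  have "poly (map_poly f p) u \<in> L \<and> \<sigma> (poly (map_poly f p) u) = poly (map_poly g p) (\<sigma> u)"
    by (induction p) (auto simp: map_poly_pCons K s u f g)
  thus "poly (map_poly f p) u \<in> L" "\<sigma> (poly (map_poly f p) u) = poly (map_poly g p) (\<sigma> u)" by auto
qed

text \<open>The third argument stays in place because it lies in the fixed field F. Zero
  denominators are harmless, as \<sigma> respects the convention a/0 = 0.\<close>

lemma aut_eval_fraction:
  assumes L: "is_subfield L" and FL: "F \<subseteq> L" and \<sigma>: "\<sigma> \<in> field_auts L F"
    and hom: "is_ring_hom \<iota>" and \<iota>: "range \<iota> \<subseteq> F" and mem: "u \<in> L" "v \<in> L" "s \<in> F"
  shows "eval_fraction \<iota> H u v s \<in> L"
    and "\<sigma> (eval_fraction \<iota> H u v s) = eval_fraction \<iota> H (\<sigma> u) (\<sigma> v) s"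
proof -
  note S = field_autsD[OF L \<sigma>] and K = is_subfieldD[OF L]
  have \<iota>F: "\<iota> c \<in> F" "\<iota> c \<in> L" for c using \<iota> FL by auto
  have 1: "poly (map_poly \<iota> q) u \<in> L" "\<sigma> (poly (map_poly \<iota> q) u) = poly (map_poly \<iota> q) (\<sigma> u)" for q
    by (rule aut_poly_map_poly[OF L \<sigma> mem(1)]; simp add: is_ring_homD[OF hom] \<iota>F S)+
  have 2: "eval2 \<iota> q u v \<in> L" "\<sigma> (eval2 \<iota> q u v) = eval2 \<iota> q (\<sigma> u) (\<sigma> v)" for q
    unfolding eval2_def by (rule aut_poly_map_poly[OF L \<sigma> mem(2)]; simp add: 1)+
  have sL: "s \<in> L" using mem FL by auto
  have 3: "eval3 \<iota> q u v s \<in> L" "\<sigma> (eval3 \<iota> q u v s) = eval3 \<iota> q (\<sigma> u) (\<sigma> v) (\<sigma> s)" for q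
    unfolding eval3_def
    by (rule aut_poly_map_poly[OF L \<sigma> sL]; simp add: 2 is_ring_homD[OF is_ring_hom_eval2[OF hom]])+
  show "eval_fraction \<iota> H u v s \<in> L"
    and "\<sigma> (eval_fraction \<iota> H u v s) = eval_fraction \<iota> H (\<sigma> u) (\<sigma> v) s"
    using mem by (simp_all add: eval_fraction_def case_prod_unfold 3 S K)
qed

section \<open>Linearity on chains\<close>

lemma lookup_map_mult:
  "Poly_Mapping.lookup (Poly_Mapping.map ((*) c) f) k = c * Poly_Mapping.lookup f k"
  for c :: "'a::mult_zero"
  by (simp add: map.rep_eq when_def)

text \<open>Extra indices have coefficient zero. A common index set lets chains with different
  supports be added termwise.\<close>

lemma act_eq_sum:
  assumes "finite A" "Poly_Mapping.keys \<gamma> \<subseteq> A"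
  shows "act \<sigma> \<gamma> = (\<Sum>p\<in>A. Poly_Mapping.single (map_prod \<sigma> \<sigma> p) (Poly_Mapping.lookup \<gamma> p))"
  unfolding act_def using assms
  by (intro sum.mono_neutral_left) (auto simp: in_keys_iff)

lemma act_add: "act \<sigma> (\<beta> + \<gamma>) = act \<sigma> \<beta> + act \<sigma> \<gamma>"
proof -
  let ?A = "Poly_Mapping.keys \<beta> \<union> Poly_Mapping.keys \<gamma>"
  show ?thesis
    using keys_add[of \<beta> \<gamma>]
    by (simp add: act_eq_sum[of ?A] lookup_add single_add sum.distrib)
qed

lemma act_sum: "act \<sigma> (\<Sum>i\<in>I. f i) = (\<Sum>i\<in>I. act \<sigma> (f i))"
  by (induction I rule: infinite_finite_induct) (simp_all add: act_add act_def[of \<sigma> 0])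

lemma act_single: "act \<sigma> (Poly_Mapping.single p c) = Poly_Mapping.single (map_prod \<sigma> \<sigma> p) c"
  by (subst act_eq_sum[of "{p}"]) auto

lemma act_map_mult: "act \<sigma> (Poly_Mapping.map ((*) c) \<gamma>) = Poly_Mapping.map ((*) c) (act \<sigma> \<gamma>)"
proof (rule poly_mapping_eqI)
  fix k
  have "Poly_Mapping.keys (Poly_Mapping.map ((*) c) \<gamma>) \<subseteq> Poly_Mapping.keys \<gamma>"
    by (auto simp: in_keys_iff lookup_map_mult)
  thus "Poly_Mapping.lookup (act \<sigma> (Poly_Mapping.map ((*) c) \<gamma>)) k
      = Poly_Mapping.lookup (Poly_Mapping.map ((*) c) (act \<sigma> \<gamma>)) k"
    by (simp add: act_eq_sum[of "Poly_Mapping.keys \<gamma>"] lookup_map_mult lookup_sum lookup_single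
        sum_distrib_left mult_when)
qed

lemma act_act: "act \<sigma> (act \<tau> \<gamma>) = act (\<sigma> \<circ> \<tau>) \<gamma>"
  by (simp add: act_def[of \<tau>] act_def[of "\<sigma> \<circ> \<tau>"] act_sum act_single map_prod.compositionality)

text \<open>The inclusion may be strict: when \<sigma> identifies points, their coefficients can
  cancel.\<close>

lemma keys_act: "Poly_Mapping.keys (act \<sigma> \<gamma>) \<subseteq> map_prod \<sigma> \<sigma> ` Poly_Mapping.keys \<gamma>"
proof -
  have "Poly_Mapping.keys (act \<sigma> \<gamma>) \<subseteq> (\<Union>p\<in>Poly_Mapping.keys \<gamma>.
      Poly_Mapping.keys (Poly_Mapping.single (map_prod \<sigma> \<sigma> p) (Poly_Mapping.lookup \<gamma> p)))"
    unfolding act_def by (rule keys_sum)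
  thus ?thesis by (auto split: if_splits)
qed

lemma keys_average:
  assumes "\<And>\<sigma>. \<sigma> \<in> G \<Longrightarrow> Poly_Mapping.keys (act \<sigma> \<gamma>) \<subseteq> A"
  shows "Poly_Mapping.keys (average G \<gamma>) \<subseteq> A"
proof -
  have "Poly_Mapping.keys (average G \<gamma>) \<subseteq> Poly_Mapping.keys (\<Sum>\<sigma>\<in>G. act \<sigma> \<gamma>)"
    by (auto simp: average_def in_keys_iff lookup_map_mult)
  also have "\<dots> \<subseteq> (\<Union>\<sigma>\<in>G. Poly_Mapping.keys (act \<sigma> \<gamma>))" by (rule keys_sum)
  finally show ?thesis using assms by blast
qed

context
  fixes \<iota> :: "complex \<Rightarrow> 'k::field"
  assumes hom: "is_ring_hom \<iota>"
begin

lemma eval_chain_eq_sum: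
  assumes "finite A" "Poly_Mapping.keys \<gamma> \<subseteq> A"
  shows "eval_chain \<iota> \<S> w x y H \<gamma> = (\<Sum>p\<in>A. \<iota> (Poly_Mapping.lookup \<gamma> p) *
    eval_fraction \<iota> H (fst p) (snd p) (1 / step_poly \<iota> \<S> w x y))"
  unfolding eval_chain_def using assms
  by (intro sum.mono_neutral_left) (auto simp: in_keys_iff is_ring_homD[OF hom])

lemma eval_chain_add:
  "eval_chain \<iota> \<S> w x y H (\<beta> + \<gamma>) = eval_chain \<iota> \<S> w x y H \<beta> + eval_chain \<iota> \<S> w x y H \<gamma>"
proof -
  let ?A = "Poly_Mapping.keys \<beta> \<union> Poly_Mapping.keys \<gamma>"
  show ?thesis
    using keys_add[of \<beta> \<gamma>]
    by (simp add: eval_chain_eq_sum[of ?A] lookup_add is_ring_homD[OF hom] distrib_right sum.distrib)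
qed

lemma eval_chain_diff:
  "eval_chain \<iota> \<S> w x y H (\<beta> - \<gamma>) = eval_chain \<iota> \<S> w x y H \<beta> - eval_chain \<iota> \<S> w x y H \<gamma>"
  using eval_chain_add[of _ _ _ _ _ "\<beta> - \<gamma>" \<gamma>] by (simp add: eq_diff_eq)

lemma eval_chain_sum:
  "eval_chain \<iota> \<S> w x y H (\<Sum>i\<in>I. f i) = (\<Sum>i\<in>I. eval_chain \<iota> \<S> w x y H (f i))"
  by (induction I rule: infinite_finite_induct) (simp_all add: eval_chain_add eval_chain_def[of _ _ _ _ _ _ 0])

lemma eval_chain_map_mult:
  "eval_chain \<iota> \<S> w x y H (Poly_Mapping.map ((*) c) \<gamma>) = \<iota> c * eval_chain \<iota> \<S> w x y H \<gamma>"
proof -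
  have "Poly_Mapping.keys (Poly_Mapping.map ((*) c) \<gamma>) \<subseteq> Poly_Mapping.keys \<gamma>"
    by (auto simp: in_keys_iff lookup_map_mult)
  thus ?thesis
    by (simp add: eval_chain_eq_sum[of "Poly_Mapping.keys \<gamma>"] lookup_map_mult is_ring_homD[OF hom]
        sum_distrib_left mult.assoc)
qed

text \<open>Linearity reduces the claim to single points. If \<sigma> identifies points of the
  support, their coefficients add up on both sides alike.\<close>

lemma eval_chain_act:
  "eval_chain \<iota> \<S> w x y H (act \<sigma> \<gamma>) = (\<Sum>p\<in>Poly_Mapping.keys \<gamma>. \<iota> (Poly_Mapping.lookup \<gamma> p) *
     eval_fraction \<iota> H (\<sigma> (fst p)) (\<sigma> (snd p)) (1 / step_poly \<iota> \<S> w x y))"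
  unfolding act_def eval_chain_sum
  by (intro sum.cong refl, subst eval_chain_eq_sum[where A = "{map_prod \<sigma> \<sigma> p}" for p])
    (auto simp: lookup_single)

end

section \<open>Averaging over an automorphism group acting on a finite generating set\<close>

text \<open>An abstraction of the orbit inside its field, with F standing for k(x) or k(y), so that
  both groups are treated by one argument.\<close>

locale finite_aut_action =
  fixes L F :: "'k::field set" and \<Omega> :: "('k \<times> 'k) set"
  assumes subfield: "is_subfield L" and base: "F \<subseteq> L" and finite: "finite \<Omega>"
    and coordinates: "\<Omega> \<subseteq> L \<times> L" and generates: "L \<subseteq> adjoin F (fst ` \<Omega> \<union> snd ` \<Omega>)"
    and stable: "\<sigma> \<in> field_auts L F \<Longrightarrow> p \<in> \<Omega> \<Longrightarrow> map_prod \<sigma> \<sigma> p \<in> \<Omega>"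
begin

abbreviation G where "G \<equiv> field_auts L F"

text \<open>The elements on which two automorphisms agree form a subfield; it contains F and all
  coordinates, and these generate L.\<close>

lemma aut_eqI:
  assumes \<sigma>: "\<sigma> \<in> G" and \<tau>: "\<tau> \<in> G" and eq: "\<And>p. p \<in> \<Omega> \<Longrightarrow> map_prod \<sigma> \<sigma> p = map_prod \<tau> \<tau> p"
  shows "\<sigma> = \<tau>"
proof -
  note s = field_autsD[OF subfield \<sigma>] and t = field_autsD[OF subfield \<tau>]
  let ?E = "{a \<in> L. \<sigma> a = \<tau> a}"
  have "is_subfield ?E"
    using subfield by (auto simp: is_subfield_def s t)
  moreover have "F \<subseteq> ?E" using base by (auto simp: s t)
  moreover have "fst ` \<Omega> \<union> snd ` \<Omega> \<subseteq> ?E"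
    using coordinates eq by (auto simp: map_prod_def case_prod_unfold)
  ultimately have "L \<subseteq> ?E"
    by (intro order.trans[OF generates] adjoin_minimal)
  thus ?thesis
    by (intro extensionalityI[OF s(4) t(4)]) auto
qed

lemma finite_auts: "finite G"
proof (rule inj_on_finite)
  show "inj_on (\<lambda>\<sigma>. restrict (map_prod \<sigma> \<sigma>) \<Omega>) G"
    by (rule inj_onI, rule aut_eqI) (assumption, assumption, metis restrict_apply')
  show "(\<lambda>\<sigma>. restrict (map_prod \<sigma> \<sigma>) \<Omega>) ` G \<subseteq> \<Omega> \<rightarrow>\<^sub>E \<Omega>"
    using stable by auto
  show "finite (\<Omega> \<rightarrow>\<^sub>E \<Omega>)" by (intro finite_PiE finite)
qed

lemma card_auts_pos: "card G > 0"
  using field_auts_id[OF subfield base] finite_auts card_gt_0_iff by blast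

lemma keys_act_subset:
  assumes "Poly_Mapping.keys \<gamma> \<subseteq> \<Omega>" "\<sigma> \<in> G"
  shows "Poly_Mapping.keys (act \<sigma> \<gamma>) \<subseteq> \<Omega>"
  by (rule order.trans[OF keys_act], rule image_subsetI, rule stable) (use assms in auto)

lemma keys_average_subset:
  assumes "Poly_Mapping.keys \<gamma> \<subseteq> \<Omega>"
  shows "Poly_Mapping.keys (average G \<gamma>) \<subseteq> \<Omega>"
  using keys_act_subset[OF assms] by (rule keys_average)

text \<open>Since \<open>compose L\<close> is meaningful only on L, the support of the chain has to
  have its coordinates there.\<close>

lemma act_compose:
  assumes "Poly_Mapping.keys \<gamma> \<subseteq> \<Omega>"
  shows "act (compose L \<sigma> \<tau>) \<gamma> = act \<sigma> (act \<tau> \<gamma>)"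
proof -
  have "map_prod (compose L \<sigma> \<tau>) (compose L \<sigma> \<tau>) p = map_prod (\<sigma> \<circ> \<tau>) (\<sigma> \<circ> \<tau>) p"
    if "p \<in> Poly_Mapping.keys \<gamma>" for p
    using that assms coordinates by (cases p) (auto simp: compose_def)
  thus ?thesis
    unfolding act_act by (simp add: act_def)
qed

text \<open>Left translation by \<sigma> is injective because \<sigma> is injective on L, and an
  injective self-map of a finite set is onto.\<close>

lemma compose_image_auts:
  assumes "\<sigma> \<in> G"
  shows "compose L \<sigma> ` G = G" and "inj_on (compose L \<sigma>) G"
proof -
  note s = field_autsD[OF subfield assms]
  show inj: "inj_on (compose L \<sigma>) G"
  proof (rule inj_onI)
    fix \<tau> \<rho> assume \<tau>: "\<tau> \<in> G" and \<rho>: "\<rho> \<in> G" and eq: "compose L \<sigma> \<tau> = compose L \<sigma> \<rho>"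
    note t = field_autsD[OF subfield \<tau>] and r = field_autsD[OF subfield \<rho>]
    show "\<tau> = \<rho>"
    proof (rule extensionalityI[OF t(4) r(4)])
      fix a assume a: "a \<in> L"
      hence "\<sigma> (\<tau> a) = \<sigma> (\<rho> a)" using fun_cong[OF eq, of a] by (simp add: compose_def)
      thus "\<tau> a = \<rho> a" using s(1) t(2)[OF a] r(2)[OF a] by (auto simp: bij_betw_def dest: inj_onD)
    qed
  qed
  show "compose L \<sigma> ` G = G"
    using field_auts_compose[OF subfield base assms] by (intro endo_inj_surj finite_auts inj) auto
qed

text \<open>Acting by \<sigma> permutes the summands of the average by left translation.\<close>

lemma act_average:
  assumes \<gamma>: "Poly_Mapping.keys \<gamma> \<subseteq> \<Omega>" and \<sigma>: "\<sigma> \<in> G"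
  shows "act \<sigma> (average G \<gamma>) = average G \<gamma>"
proof -
  have "act \<sigma> (\<Sum>\<tau>\<in>G. act \<tau> \<gamma>) = (\<Sum>\<tau>\<in>G. act (compose L \<sigma> \<tau>) \<gamma>)"
    by (simp add: act_sum act_compose[OF \<gamma>])
  also have "\<dots> = (\<Sum>\<tau>\<in>compose L \<sigma> ` G. act \<tau> \<gamma>)"
    by (simp add: sum.reindex compose_image_auts(2)[OF \<sigma>])
  finally show ?thesis
    by (simp add: average_def act_map_mult compose_image_auts(1)[OF \<sigma>])
qed

text \<open>Each translate of the chain evaluates to the image under \<sigma> of a value in F, which
  is that value itself. The average is therefore a mean of equal values.\<close>

lemma eval_chain_average:
  assumes hom: "is_ring_hom \<iota>" and \<iota>: "range \<iota> \<subseteq> F" and s: "1 / step_poly \<iota> \<S> w x y \<in> F"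
    and \<gamma>: "Poly_Mapping.keys \<gamma> \<subseteq> \<Omega>" and fixed: "eval_chain \<iota> \<S> w x y H \<gamma> \<in> F"
  shows "eval_chain \<iota> \<S> w x y H (average G \<gamma>) = eval_chain \<iota> \<S> w x y H \<gamma>"
proof -
  let ?e = "eval_chain \<iota> \<S> w x y H"
  have "?e (act \<sigma> \<gamma>) = ?e \<gamma>" if \<sigma>: "\<sigma> \<in> G" for \<sigma>
  proof -
    note S = field_autsD[OF subfield \<sigma>] and K = is_subfieldD[OF subfield]
    note ev = aut_eval_fraction[OF subfield base \<sigma> hom \<iota> _ _ s]
    have \<iota>F: "\<iota> c \<in> F" "\<iota> c \<in> L" for c using \<iota> base by auto
    have co: "fst p \<in> L" "snd p \<in> L" if "p \<in> Poly_Mapping.keys \<gamma>" for p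
      using that \<gamma> subsetD[OF coordinates] unfolding mem_Times_iff by blast+
    have "?e (act \<sigma> \<gamma>) = \<sigma> (?e \<gamma>)"
      unfolding eval_chain_act[OF hom] eval_chain_def[of _ _ _ _ _ _ \<gamma>]
      by (subst S(14)) (simp_all add: K S \<iota>F co ev)
    thus ?thesis using fixed by (simp add: S)
  qed
  hence "?e (average G \<gamma>) = \<iota> (1 / of_nat (card G)) * (of_nat (card G) * ?e \<gamma>)"
    by (simp add: average_def eval_chain_map_mult[OF hom] eval_chain_sum[OF hom])
  \<comment> \<open>The factor 1/|G| is a complex scalar under the embedding, so |G| is rewritten as
    an embedded scalar too and cancelled in C, where it is nonzero.\<close>
  also have "of_nat (card G) = \<iota> (of_nat (card G))"
    using is_ring_homD(8)[OF hom, of "\<lambda>_. 1" "{..<card G}"] is_ring_homD(2)[OF hom] by simp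
  also have "\<iota> (1 / of_nat (card G)) * (\<iota> (of_nat (card G)) * ?e \<gamma>)
      = \<iota> (1 / of_nat (card G) * of_nat (card G)) * ?e \<gamma>"
    by (simp only: is_ring_homD(4)[OF hom] mult.assoc)
  also have "\<dots> = ?e \<gamma>"
    using card_auts_pos is_ring_homD(2)[OF hom] by simp
  finally show ?thesis .
qed

end

section \<open>The action on the orbit\<close>

lemma aut_step_poly:
  assumes L: "is_subfield L" and \<sigma>: "\<sigma> \<in> field_auts L F"
    and \<iota>: "range \<iota> \<subseteq> F" "F \<subseteq> L" and mem: "u \<in> L" "v \<in> L"
  shows "\<sigma> (step_poly \<iota> \<S> w u v) = step_poly \<iota> \<S> w (\<sigma> u) (\<sigma> v)"
proof -
  note S = field_autsD[OF L \<sigma>] and K = is_subfieldD[OF L]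
  have \<iota>F: "\<iota> c \<in> F" "\<iota> c \<in> L" for c using \<iota> by auto
  show ?thesis
    unfolding step_poly_def case_prod_unfold by (simp add: S K \<iota>F mem)
qed

text \<open>An automorphism preserves both relations, hence carries a chain of links from (x,y) to p
  to one starting at the image of (x,y). Only that image has to be known to lie in the
  orbit.\<close>

lemma aut_orbit:
  assumes L: "is_subfield L" and \<sigma>: "\<sigma> \<in> field_auts L F"
    and \<iota>: "range \<iota> \<subseteq> F" "F \<subseteq> L" and coords: "orbit \<iota> \<S> w x y \<subseteq> L \<times> L"
    and start: "map_prod \<sigma> \<sigma> (x, y) \<in> orbit \<iota> \<S> w x y" and p: "p \<in> orbit \<iota> \<S> w x y"
  shows "map_prod \<sigma> \<sigma> p \<in> orbit \<iota> \<S> w x y"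
proof -
  let ?r = "\<lambda>q r. sim_x \<iota> \<S> w q r \<or> sim_y \<iota> \<S> w q r"
  note S = field_autsD[OF L \<sigma>]
  have sim: "?r (map_prod \<sigma> \<sigma> q) (map_prod \<sigma> \<sigma> r)"
    if "?r q r" "q \<in> orbit \<iota> \<S> w x y" "r \<in> orbit \<iota> \<S> w x y" for q r
  proof -
    have "fst q \<in> L" "snd q \<in> L" "fst r \<in> L" "snd r \<in> L"
      using that subsetD[OF coords] unfolding mem_Times_iff by blast+
    thus ?thesis
      using that(1) unfolding sim_x_def sim_y_def nonzero_pair_def
      by (auto simp: S simp flip: aut_step_poly[OF L \<sigma> \<iota>])
  qed
  have "equivclp ?r (x, y) p" using p by (simp add: orbit_def)
  thus ?thesis
  proof (induction rule: equivclp_induct)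
    case base
    show ?case by (rule start)
  next
    case (step q r)
    \<comment> \<open>Both ends of the link must lie in the orbit, so that their coordinates are in
      L, where \<sigma> is a homomorphism.\<close>
    have "equivclp ?r (x, y) r"
      using step.hyps by (rule equivclp_into_equivclp)
    hence "q \<in> orbit \<iota> \<S> w x y" "r \<in> orbit \<iota> \<S> w x y"
      using step.hyps(1) by (simp_all add: orbit_def)
    hence sim': "?r (map_prod \<sigma> \<sigma> q) (map_prod \<sigma> \<sigma> r) \<or> ?r (map_prod \<sigma> \<sigma> r) (map_prod \<sigma> \<sigma> q)"
      using sim step.hyps(2) by blast
    show ?case
      using equivclp_into_equivclp[where r = ?r, OF _ sim'] step.IH by (simp add: orbit_def)
  qed
qed

lemma finite_aut_action_orbit:
  assumes fin: "finite (orbit \<iota> \<S> w x y)" and nz: "x \<noteq> 0" "y \<noteq> 0" and z: "z \<in> {x, y}"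
  shows "finite_aut_action (orbit_field \<iota> \<S> w x y) (adjoin (base_field \<iota> \<S> w x y) {z}) (orbit \<iota> \<S> w x y)"
proof -
  let ?O = "orbit \<iota> \<S> w x y" and ?k = "base_field \<iota> \<S> w x y"
  let ?L = "orbit_field \<iota> \<S> w x y" and ?F = "adjoin ?k {z}"
  have L: "is_subfield ?L" by (simp add: orbit_field_def is_subfield_adjoin)
  have kL: "?k \<subseteq> ?L" and coords: "fst ` ?O \<union> snd ` ?O \<subseteq> ?L"
    unfolding orbit_field_def by (rule adjoin_superset)+
  have xy: "(x, y) \<in> ?O" by (simp add: orbit_def)
  hence xyL: "x \<in> ?L" "y \<in> ?L" using coords by force+
  have FL: "?F \<subseteq> ?L" using L kL xyL z by (intro adjoin_minimal) auto
  have k: "range \<iota> \<subseteq> ?k" "step_poly \<iota> \<S> w x y \<in> ?k"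
    using adjoin_superset(1)[of "range \<iota>"] adjoin_superset(2)[of "{step_poly \<iota> \<S> w x y}"]
    unfolding base_field_def by auto
  hence \<iota>: "range \<iota> \<subseteq> ?F" and SF: "step_poly \<iota> \<S> w x y \<in> ?F"
    using adjoin_superset(1)[of ?k "{z}"] by auto
  have zF: "z \<in> ?F" using adjoin_superset(2)[of "{z}" ?k] by simp
  have coords': "?O \<subseteq> ?L \<times> ?L" using coords by (force simp: mem_Times_iff)
  show ?thesis
  proof
    show "?L \<subseteq> adjoin ?F (fst ` ?O \<union> snd ` ?O)"
      unfolding orbit_field_def
      using adjoin_superset(1)[of ?k "{z}"] adjoin_superset(1)[of ?F "fst ` ?O \<union> snd ` ?O"]
        adjoin_superset(2)[of "fst ` ?O \<union> snd ` ?O" ?F]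
      by (intro adjoin_minimal is_subfield_adjoin) auto
    fix \<sigma> p assume \<sigma>: "\<sigma> \<in> field_auts ?L ?F" and p: "p \<in> ?O"
    note S = field_autsD[OF L \<sigma>]
    have "step_poly \<iota> \<S> w (\<sigma> x) (\<sigma> y) = step_poly \<iota> \<S> w x y"
      using aut_step_poly[OF L \<sigma> \<iota> FL xyL] S(3)[OF SF] by simp
    \<comment> \<open>As \<sigma> fixes S(x,y) and one of the two coordinates, the image of (x,y) is
      a neighbour of (x,y): along \<open>sim_x\<close> for z = x, along \<open>sim_y\<close> for z =
      y.\<close>
    hence "sim_x \<iota> \<S> w (x, y) (\<sigma> x, \<sigma> y) \<or> sim_y \<iota> \<S> w (x, y) (\<sigma> x, \<sigma> y)"
      using z S(3)[OF zF] nz S(12) xyL by (auto simp: sim_x_def sim_y_def nonzero_pair_def)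
    hence "map_prod \<sigma> \<sigma> (x, y) \<in> ?O"
      by (auto simp: orbit_def intro: r_into_equivclp)
    thus "map_prod \<sigma> \<sigma> p \<in> ?O"
      by (rule aut_orbit[OF L \<sigma> \<iota> FL coords' _ p])
  qed (fact L FL fin coords')+
qed

section \<open>Passage from pseudo-decouplings to decouplings\<close>

theorem mainTheorem9:
  fixes \<iota> :: "complex \<Rightarrow> 'k::alg_closed_field" and x y :: 'k
    and \<S> :: "(int \<times> int) set" and w :: "int \<times> int \<Rightarrow> complex"
    and \<gamma>\<^sub>x \<gamma>\<^sub>y :: "'k chain"
  assumes "weighted_steps \<S> w"
    and "alg_closure_of_Cxy \<iota> x y"
    and "finite (orbit \<iota> \<S> w x y)"
    and "zero_chain \<iota> \<S> w x y \<gamma>\<^sub>x" and "zero_chain \<iota> \<S> w x y \<gamma>\<^sub>y"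
    and "pseudo_decoupling \<iota> \<S> w x y \<gamma>\<^sub>x \<gamma>\<^sub>y"
  shows "let G\<^sub>x = group_x \<iota> \<S> w x y;
             G\<^sub>y = group_y \<iota> \<S> w x y;
             \<gamma>\<^sub>x' = average G\<^sub>x \<gamma>\<^sub>x;
             \<gamma>\<^sub>y' = average G\<^sub>y \<gamma>\<^sub>y;
             \<alpha> = Poly_Mapping.single (x, y) 1 - \<gamma>\<^sub>x' - \<gamma>\<^sub>y'
         in (\<forall>\<sigma>\<in>G\<^sub>x. act \<sigma> \<gamma>\<^sub>x' = \<gamma>\<^sub>x')
          \<and> (\<forall>\<sigma>\<in>G\<^sub>y. act \<sigma> \<gamma>\<^sub>y' = \<gamma>\<^sub>y')
          \<and> cancels_decoupled \<iota> \<S> w x y \<alpha>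
          \<and> is_decoupling \<iota> \<S> w x y \<gamma>\<^sub>x' \<gamma>\<^sub>y' \<alpha>"
proof -
  have hom: "is_ring_hom \<iota>" and indep: "alg_independent2 \<iota> x y"
    using assms(2) by (auto simp: alg_closure_of_Cxy_def field_embedding_is_ring_hom)
  note nz = alg_independent2_nonzero[OF hom indep]
  let ?O = "orbit \<iota> \<S> w x y" and ?k = "base_field \<iota> \<S> w x y" and ?L = "orbit_field \<iota> \<S> w x y"
  interpret X: finite_aut_action ?L "adjoin ?k {x}" ?O
    by (rule finite_aut_action_orbit[OF assms(3) nz]) simp
  interpret Y: finite_aut_action ?L "adjoin ?k {y}" ?O
    by (rule finite_aut_action_orbit[OF assms(3) nz]) simp
  define \<gamma>\<^sub>x' \<gamma>\<^sub>y' where "\<gamma>\<^sub>x' = average (group_x \<iota> \<S> w x y) \<gamma>\<^sub>x"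
    and "\<gamma>\<^sub>y' = average (group_y \<iota> \<S> w x y) \<gamma>\<^sub>y"
  define \<alpha> where "\<alpha> = Poly_Mapping.single (x, y) 1 - \<gamma>\<^sub>x' - \<gamma>\<^sub>y'"
  have keys: "Poly_Mapping.keys \<gamma>\<^sub>x \<subseteq> ?O" "Poly_Mapping.keys \<gamma>\<^sub>y \<subseteq> ?O"
    using assms(4,5) by (simp_all add: zero_chain_def)
  have keys': "Poly_Mapping.keys \<gamma>\<^sub>x' \<subseteq> ?O" "Poly_Mapping.keys \<gamma>\<^sub>y' \<subseteq> ?O"
    unfolding \<gamma>\<^sub>x'_def \<gamma>\<^sub>y'_def group_x_def group_y_def
    by (rule X.keys_average_subset[OF keys(1)], rule Y.keys_average_subset[OF keys(2)])
  have "(x, y) \<in> ?O" by (simp add: orbit_def)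
  hence keys_\<alpha>: "Poly_Mapping.keys \<alpha> \<subseteq> ?O"
    using keys' keys_diff[of "Poly_Mapping.single (x, y) 1 - \<gamma>\<^sub>x'" \<gamma>\<^sub>y']
      keys_diff[of "Poly_Mapping.single (x, y) 1" \<gamma>\<^sub>x'] unfolding \<alpha>_def by auto
  have inv_x: "\<forall>\<sigma>\<in>group_x \<iota> \<S> w x y. act \<sigma> \<gamma>\<^sub>x' = \<gamma>\<^sub>x'"
    unfolding \<gamma>\<^sub>x'_def group_x_def using X.act_average[OF keys(1)] by blast
  have inv_y: "\<forall>\<sigma>\<in>group_y \<iota> \<S> w x y. act \<sigma> \<gamma>\<^sub>y' = \<gamma>\<^sub>y'"
    unfolding \<gamma>\<^sub>y'_def group_y_def using Y.act_average[OF keys(2)] by blast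
  have k: "range \<iota> \<subseteq> ?k" "step_poly \<iota> \<S> w x y \<in> ?k"
    using adjoin_superset(1)[of "range \<iota>"] adjoin_superset(2)[of "{step_poly \<iota> \<S> w x y}"]
    unfolding base_field_def by auto
  have "1 / step_poly \<iota> \<S> w x y \<in> ?k"
    using is_subfieldD(2,6)[OF is_subfield_adjoin] k(2) unfolding base_field_def by blast
  hence sub: "range \<iota> \<subseteq> adjoin ?k {z}" "1 / step_poly \<iota> \<S> w x y \<in> adjoin ?k {z}" for z
    using k(1) adjoin_superset(1)[of ?k "{z}"] by auto
  have cancels: "cancels_decoupled \<iota> \<S> w x y \<alpha>"
    unfolding cancels_decoupled_def
  proof (intro ballI)
    fix F E assume FE: "F \<in> fractions_X_t" "E \<in> fractions_Y_t"
    let ?e = "eval_chain \<iota> \<S> w x y (F + E)"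
    have "0 \<in> fractions_X_t" "0 \<in> fractions_Y_t"
      by (simp_all add: fractions_X_t_def fractions_Y_t_def is_subfieldD(1) is_subfield_adjoin)
    \<comment> \<open>Zero is the sum of the zeros of the two fraction fields, so regularity of the
      zero remainder is itself an instance of \<open>regular_decoupled\<close>.\<close>
    hence "regular \<S> w 0"
      using regular_decoupled[OF hom indep assms(1)] by force
    hence "galois_decoupling \<S> w (F + E)"
      using FE by (rule galois_decoupling_decoupled)
    hence pd: "?e (Poly_Mapping.single (x, y) 1) = ?e \<gamma>\<^sub>x + ?e \<gamma>\<^sub>y"
      "?e \<gamma>\<^sub>x \<in> adjoin ?k {x}" "?e \<gamma>\<^sub>y \<in> adjoin ?k {y}"
      using assms(6) regular_decoupled[OF hom indep assms(1) FE] unfolding pseudo_decoupling_def by blast+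
    have "?e \<gamma>\<^sub>x' = ?e \<gamma>\<^sub>x"
      unfolding \<gamma>\<^sub>x'_def group_x_def by (rule X.eval_chain_average[OF hom sub keys(1) pd(2)])
    moreover have "?e \<gamma>\<^sub>y' = ?e \<gamma>\<^sub>y"
      unfolding \<gamma>\<^sub>y'_def group_y_def by (rule Y.eval_chain_average[OF hom sub keys(2) pd(3)])
    \<comment> \<open>Once the averages are replaced by the original chains, the value at
      \<open>\<alpha>\<close> is the difference of the two sides of the pseudo-decoupling
      identity.\<close>
    ultimately show "?e \<alpha> = 0"
      by (simp add: \<alpha>_def eval_chain_diff[OF hom] pd(1))
  qed
  moreover have "is_decoupling \<iota> \<S> w x y \<gamma>\<^sub>x' \<gamma>\<^sub>y' \<alpha>"
    using inv_x inv_y cancels keys' keys_\<alpha>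
    by (simp add: is_decoupling_def zero_chain_def \<alpha>_def)
  ultimately show ?thesis
    using inv_x inv_y unfolding Let_def \<gamma>\<^sub>x'_def \<gamma>\<^sub>y'_def \<alpha>_def by blast
qed

end
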